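(* Let $\{T(u)\}_{u\ge0}$ be a $C_0$ semigroup of contractions on a Banach space $B$ whose norm satisfies, for some $2\le s<\infty$ and some $m>0$, $$\max\big(\|F+G\|_B,\|F-G\|_B\big)\ge\big(\|F\|_B^s+m\|G\|_B^s\big)^{1/s}\quad\text{for all }F,G\in B,$$ and let $r\ge1$ be an integer. Then there is a constant $C>0$, independent of $f$ and $t$, such that for all $f\in B$ and $t>0$ $$\omega_T^r(f,t)_B\ge C\Big\{\sum_{j=1}^\infty2^{-jrs}\,\omega_T^{r+1}(f,2^jt)_B^s\Big\}^{1/s}.$$
   Context: A $C_0$ semigroup of contractions is a family of linear operators $T(t):B\to B$, $t\ge0$, with $T(t+s)=T(t)T(s)$, $\lim_{t\to0+}\|T(t)f-f\|_B=0$ and $\|T(t)f\|_B\le\|f\|_B$ for all $f\in B$, $t\ge0$. For an integer $k\ge1$, $\omega_T^k(f,t)_B=\sup_{0\le u\le t}\|(T(u)-I)^kf\|_B$. *)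

theory Defs
  imports "HOL-Analysis.Analysis"
begin

(* Banach spaces are real here; a complex Banach space with complex-linear operators is
   covered by restriction of scalars. Only the values T t with t >= 0 matter.
   T 0 = I is not assumed: it follows from the other conditions. *)
definition c0_contraction_semigroup :: "(real \<Rightarrow> 'a \<Rightarrow> 'a::banach) \<Rightarrow> bool" where
  "c0_contraction_semigroup T \<longleftrightarrow>
     (\<forall>t\<ge>0. linear (T t)) \<and>
     (\<forall>t\<ge>0. \<forall>u\<ge>0. \<forall>f. T (t + u) f = T t (T u f)) \<and>
     (\<forall>f. ((\<lambda>t. norm (T t f - f)) \<longlongrightarrow> 0) (at_right 0)) \<and>
     (\<forall>t\<ge>0. \<forall>f. norm (T t f) \<le> norm f)"

(* The real-valued supremum is the intended one for t >= 0 and a contraction semigroup T: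
   the set is nonempty and bounded above by 2 ^ k * norm f. *)
definition semigroup_modulus :: "(real \<Rightarrow> 'a \<Rightarrow> 'a::banach) \<Rightarrow> nat \<Rightarrow> 'a \<Rightarrow> real \<Rightarrow> real" where
  "semigroup_modulus T k f t = (SUP u\<in>{0..t}. norm (((\<lambda>g. T u g - g) ^^ k) f))"

end

theory Submission
  imports Defs
begin

text \<open>
  Write \<open>D\<^sub>u = T u - I\<close> and \<open>g = D\<^sub>u\<^sup>r f\<close>. The vectors \<open>F = (T u g + g) / 2\<close> and \<open>G = (T u g - g) / 2\<close>
  satisfy \<open>F + G = T u g\<close> and \<open>F - G = g\<close>, both of norm at most \<open>\<parallel>g\<parallel>\<close>. Moreover \<open>G\<close> is half of
  \<open>D\<^sub>u\<^sup>r\<^sup>+\<^sup>1 f\<close>, and \<open>D\<^sub>2\<^sub>u = (T u + I) D\<^sub>u\<close> gives \<open>\<parallel>F\<parallel> \<ge> 2\<^sup>-\<^sup>r \<parallel>D\<^sub>2\<^sub>u\<^sup>r f\<parallel>\<close>. The convexity hypothesis on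
  the norm thus becomes a doubling inequality (\<open>difference_doubling\<close>):
  \<open>\<parallel>D\<^sub>u\<^sup>r f\<parallel>\<^sup>s \<ge> 2\<^sup>-\<^sup>r\<^sup>s \<parallel>D\<^sub>2\<^sub>u\<^sup>r f\<parallel>\<^sup>s + m 2\<^sup>-\<^sup>s \<parallel>D\<^sub>u\<^sup>r\<^sup>+\<^sup>1 f\<parallel>\<^sup>s\<close>.
  Iterating it along \<open>u, 2u, 4u, ...\<close> bounds the dyadic sum of \<open>\<parallel>D\<^sub>v\<^sup>r\<^sup>+\<^sup>1 f\<parallel>\<^sup>s\<close> over \<open>v = 2\<^sup>j u\<close>
  by \<open>\<parallel>D\<^sub>u\<^sup>r f\<parallel>\<^sup>s\<close> (\<open>difference_ge_dyadic_sum\<close>).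

  This holds for one common \<open>u\<close>, whereas the moduli in the theorem are suprema over ranges of
  \<open>u\<close>, approached at unrelated points for different \<open>j\<close>. Averaging over \<open>u \<in> [0, t]\<close> removes the
  conflict: the mean of \<open>\<parallel>D\<^sub>u\<^sup>r f\<parallel>\<^sup>s\<close> stays below \<open>\<omega>\<^sup>r(f, t)\<^sup>s\<close>, and every term of the dyadic sum turns
  into a mean of \<open>\<parallel>D\<^sub>v\<^sup>r\<^sup>+\<^sup>1 f\<parallel>\<^sup>s\<close> over \<open>v \<in> [0, 2\<^sup>j t]\<close>,
  which controls the corresponding supremum. The latter comparison (\<open>modulus_le_average\<close>) rests
  on the identity \<open>difference_identity\<close>, which expresses \<open>D\<^sub>h\<^sup>n\<close> for a fixed step \<open>h\<close> through
  differences with steps \<open>kv\<close> and \<open>h + kv\<close>, where \<open>v\<close> is a free parameter to average over. It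
  compares the supremum over \<open>[0, \<tau>]\<close> with the mean over \<open>[0, 2\<tau>]\<close>; this loss of one dyadic scale
  costs only an index shift in the sum, hence a factor \<open>2\<^sup>r\<^sup>s\<close>.
\<close>

section \<open>Powers of sums and rescaled integrals\<close>

lemma powr_sum_le:
  fixes a :: "'i \<Rightarrow> real"
  assumes "finite I" and nonneg: "\<And>i. i \<in> I \<Longrightarrow> 0 \<le> a i" and "0 < s"
  shows "(\<Sum>i\<in>I. a i) powr s \<le> real (card I) powr s * (\<Sum>i\<in>I. a i powr s)"
proof (cases "I = {}")
  case True
  then show ?thesis using \<open>0 < s\<close> by simp
next
  case False
  define M where "M = Max (a ` I)"
  have "M \<in> a ` I" unfolding M_def using assms(1) False by simp
  then obtain i where i: "i \<in> I" "M = a i" by auto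
  have "(\<Sum>i\<in>I. a i) \<le> real (card I) * M"
    by (rule sum_bounded_above) (simp add: M_def assms(1))
  then have "(\<Sum>i\<in>I. a i) powr s \<le> (real (card I) * M) powr s"
    using nonneg \<open>0 < s\<close> by (intro powr_mono2) (auto intro: sum_nonneg)
  also have "\<dots> = real (card I) powr s * a i powr s"
    using i nonneg by (simp add: powr_mult)
  also have "\<dots> \<le> real (card I) powr s * (\<Sum>i\<in>I. a i powr s)"
    using i assms(1) by (intro mult_left_mono member_le_sum) auto
  finally show ?thesis .
qed

text \<open>
  Undoing the affine substitutions, the two sides are the integrals of \<open>\<phi>\<close> over \<open>[b, b + a]\<close>
  and over the larger interval \<open>[0, c]\<close>.
\<close>

lemma integral_affine_le:
  fixes \<phi> :: "real \<Rightarrow> real"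
  assumes cont: "continuous_on {0..} \<phi>" and nonneg: "\<And>x. 0 \<le> x \<Longrightarrow> 0 \<le> \<phi> x"
    and "0 \<le> b" "0 < a" "b + a \<le> c"
  shows "a * integral {0..1} (\<lambda>x. \<phi> (b + a * x)) \<le> c * integral {0..1} (\<lambda>x. \<phi> (c * x))"
proof -
  have affine: "a' * integral {0..1} (\<lambda>x. \<phi> (b' + a' * x)) = integral {b'..b' + a'} \<phi>"
    if "0 \<le> b'" "0 < a'" for a' b'
  proof -
    have "\<phi> integrable_on {b'..b' + a'}"
      using that by (intro integrable_continuous_interval continuous_on_subset[OF cont]) auto
    then have "(\<phi> has_integral integral {b'..b' + a'} \<phi>) (cbox b' (b' + a'))"
      by (simp add: integrable_integral)
    from has_integral_affinity[OF this, of a' b'] that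
    have "((\<lambda>x. \<phi> (a' * x + b')) has_integral (integral {b'..b' + a'} \<phi> / a'))
        ((\<lambda>x. (1 / a') *\<^sub>R x + - ((1 / a') *\<^sub>R b')) ` {b'..b' + a'})"
      by simp
    moreover have "(\<lambda>x. (1 / a') *\<^sub>R x + - ((1 / a') *\<^sub>R b')) ` {b'..b' + a'} = {0..1}"
      using that image_affinity_atLeastAtMost[of "1 / a'" "- (b' / a')" b' "b' + a'"]
      by (simp add: field_simps)
    ultimately have "integral {0..1} (\<lambda>x. \<phi> (a' * x + b')) = integral {b'..b' + a'} \<phi> / a'"
      by (simp add: integral_unique)
    then show ?thesis using that by (simp add: add.commute)
  qed
  have "integral {b..b + a} \<phi> \<le> integral {0..c} \<phi>"
    using assms by (intro integral_subset_le integrable_continuous_interval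
        continuous_on_subset[OF cont]) auto
  then show ?thesis
    using affine[of b a] affine[of 0 c] assms by simp
qed

section \<open>Differences of a single operator\<close>

abbreviation difference :: "('a \<Rightarrow> 'a::real_vector) \<Rightarrow> nat \<Rightarrow> 'a \<Rightarrow> 'a" where
  "difference A n f \<equiv> ((\<lambda>g. A g - g) ^^ n) f"

lemma difference_expansion:
  assumes "linear A"
  shows "difference A n f = (\<Sum>l\<le>n. ((-1) ^ (n + l) * real (n choose l)) *\<^sub>R (A ^^ l) f)"
proof (induction n arbitrary: f)
  case 0
  then show ?case by simp
next
  case (Suc n)
  define c :: "nat \<Rightarrow> nat \<Rightarrow> real" where "c n l = (-1) ^ (n + l) * real (n choose l)" for n l
  have lin: "(A ^^ l) (A f - f) = (A ^^ Suc l) f - (A ^^ l) f" for l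
  proof (induction l)
    case (Suc l)
    then show ?case using linear_diff[OF assms] by simp
  qed simp
  have pascal: "c (Suc n) (Suc l) = c n l - c n (Suc l)" for l
    by (simp add: c_def algebra_simps)
  have "difference A (Suc n) f = difference A n (A f - f)"
    by (simp only: funpow_Suc_right o_apply)
  also have "\<dots> = (\<Sum>l\<le>n. c n l *\<^sub>R ((A ^^ Suc l) f - (A ^^ l) f))"
    using Suc[of "A f - f"] by (simp only: lin c_def)
  also have "\<dots> = (\<Sum>l\<le>n. c n l *\<^sub>R (A ^^ Suc l) f) - (\<Sum>l\<le>Suc n. c n l *\<^sub>R (A ^^ l) f)"
    by (simp add: scaleR_diff_right sum_subtractf c_def)
  also have "\<dots> = (\<Sum>l\<le>n. c (Suc n) (Suc l) *\<^sub>R (A ^^ Suc l) f) - c n 0 *\<^sub>R f"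
    by (simp only: sum.atMost_Suc_shift pascal scaleR_diff_left sum_subtractf) simp
  also have "\<dots> = (\<Sum>l\<le>Suc n. c (Suc n) l *\<^sub>R (A ^^ l) f)"
    by (subst sum.atMost_Suc_shift) (simp add: c_def)
  finally show ?case by (simp only: c_def)
qed

text \<open>
  With \<open>S = A + I\<close> one has \<open>A\<^sup>2 - I = S (A - I)\<close>, and the two factors commute. One of the \<open>r\<close>
  factors \<open>S\<close> is kept to form the half sum \<open>F\<close> in the convexity hypothesis; the others cost
  at most a factor 2 each.
\<close>

lemma difference_doubling:
  fixes A :: "'a::real_normed_vector \<Rightarrow> 'a"
  assumes "linear A" and contraction: "\<And>g. norm (A g) \<le> norm g"
    and "0 < s" and "0 < m" and "1 \<le> r"
    and convex: "\<And>F G :: 'a. max (norm (F + G)) (norm (F - G))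
            \<ge> (norm F powr s + m * norm G powr s) powr (1 / s)"
  shows "norm (difference A r f) powr s
    \<ge> 2 powr (- (real r * s)) * norm (difference (A \<circ> A) r f) powr s
      + m * 2 powr (- s) * norm (difference A (Suc r) f) powr s"
proof -
  define S where "S g = A g + g" for g
  define g where "g = difference A r f"
  have commute: "A (S x) - S x = S (A x - x)" for x
    using \<open>linear A\<close> by (simp add: S_def linear_add linear_diff)
  have commute_pow: "A ((S ^^ n) x) - (S ^^ n) x = (S ^^ n) (A x - x)" for n x
    by (induction n) (simp_all add: commute)
  have square: "A (A x) - x = S (A x - x)" for x
    using linear_diff[OF \<open>linear A\<close>] by (simp add: S_def)
  have "difference (A \<circ> A) n f = (S ^^ n) (difference A n f)" for n
  proof (induction n)
    case (Suc n)
    have "difference (A \<circ> A) (Suc n) f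
        = A (A ((S ^^ n) (difference A n f))) - (S ^^ n) (difference A n f)"
      using Suc by simp
    also have "\<dots> = (S ^^ Suc n) (difference A (Suc n) f)"
      by (simp only: square commute_pow) simp
    finally show ?case .
  qed simp
  then have factor: "difference (A \<circ> A) r f = (S ^^ r) g"
    by (simp add: g_def)
  have S_le: "norm (S x) \<le> 2 * norm x" for x
    using norm_triangle_ineq[of "A x" x] contraction[of x] by (simp add: S_def)
  have S_pow_le: "norm ((S ^^ n) x) \<le> 2 ^ n * norm x" for n x
  proof (induction n)
    case (Suc n)
    then show ?case using S_le[of "(S ^^ n) x"] by simp
  qed simp
  obtain q where q: "r = Suc q" using \<open>1 \<le> r\<close> by (cases r) auto
  have "norm (difference (A \<circ> A) r f) = norm ((S ^^ q) (S g))"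
    by (simp only: factor) (simp only: q funpow_Suc_right o_apply)
  also have "\<dots> \<le> 2 ^ q * norm (S g)" by (rule S_pow_le)
  finally have le: "norm (difference (A \<circ> A) r f) / 2 ^ r \<le> norm ((1/2) *\<^sub>R S g)"
    by (simp add: q field_simps)
  have "2 powr (- (real r * s)) * norm (difference (A \<circ> A) r f) powr s
      = (norm (difference (A \<circ> A) r f) / 2 ^ r) powr s"
    by (simp add: powr_divide powr_minus powr_realpow[symmetric] powr_powr field_simps)
  also have "\<dots> \<le> norm ((1/2) *\<^sub>R S g) powr s"
    using le \<open>0 < s\<close> by (intro powr_mono2) auto
  finally have first: "2 powr (- (real r * s)) * norm (difference (A \<circ> A) r f) powr s
      \<le> norm ((1/2) *\<^sub>R S g) powr s" .
  have half: "norm ((1/2) *\<^sub>R x) powr s = 2 powr (- s) * norm x powr s" for x :: 'a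
    by (simp add: powr_divide powr_minus field_simps)
  have second: "m * 2 powr (- s) * norm (difference A (Suc r) f) powr s
      = m * norm ((1/2) *\<^sub>R (A g - g)) powr s"
    by (simp only: half g_def funpow.simps o_apply mult.assoc)
  let ?F = "(1/2) *\<^sub>R S g" and ?G = "(1/2) *\<^sub>R (A g - g)"
  have "?F + ?G = A g" "?F - ?G = g"
    by (simp_all add: S_def algebra_simps flip: scaleR_add_left)
  then have "(norm ?F powr s + m * norm ?G powr s) powr (1 / s) \<le> norm g"
    using convex[of ?F ?G] contraction[of g] by (metis max.absorb2)
  then have "((norm ?F powr s + m * norm ?G powr s) powr (1 / s)) powr s \<le> norm g powr s"
    using \<open>0 < s\<close> by (intro powr_mono2) auto
  then have "norm ?F powr s + m * norm ?G powr s \<le> norm g powr s"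
    using \<open>0 < s\<close> \<open>0 < m\<close> by (simp add: powr_powr)
  then show ?thesis using first second unfolding g_def by linarith
qed

section \<open>Orbits and differences of a contraction semigroup\<close>

locale contraction_semigroup =
  fixes T :: "real \<Rightarrow> 'a \<Rightarrow> 'a::banach"
  assumes semigroup: "c0_contraction_semigroup T"
begin

lemma linear: "0 \<le> t \<Longrightarrow> linear (T t)"
  and add: "0 \<le> t \<Longrightarrow> 0 \<le> u \<Longrightarrow> T (t + u) f = T t (T u f)"
  and tendsto_norm: "((\<lambda>t. norm (T t f - f)) \<longlongrightarrow> 0) (at_right 0)"
  and contraction: "0 \<le> t \<Longrightarrow> norm (T t f) \<le> norm f"
  using semigroup by (auto simp: c0_contraction_semigroup_def)

lemma diff: "0 \<le> t \<Longrightarrow> T t (f - g) = T t f - T t g"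
  using linear by (rule linear_diff)

text \<open>
  Since \<open>T 0 (T t f) = T t f\<close> for \<open>t > 0\<close>, the bounded operator \<open>T 0\<close> fixes the limit \<open>f\<close> of \<open>T t f\<close>.
\<close>

lemma zero: "T 0 f = f"
proof -
  have lim: "((\<lambda>t. T t f) \<longlongrightarrow> f) (at_right 0)"
    using tendsto_norm[of f] by (simp add: tendsto_norm_zero_iff LIM_zero_iff)
  have "bounded_linear (T 0)"
    using linear[of 0] contraction[of 0]
    by (intro bounded_linear_intro[where K = 1]) (auto simp: linear_add linear_scale)
  from bounded_linear.tendsto[OF this lim]
  have "((\<lambda>t. T 0 (T t f)) \<longlongrightarrow> T 0 f) (at_right 0)" .
  moreover have "\<forall>\<^sub>F t in at_right 0. T 0 (T t f) = T t f"
    unfolding eventually_at_filter by (auto simp: add[symmetric])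
  ultimately have "((\<lambda>t. T t f) \<longlongrightarrow> T 0 f) (at_right 0)"
    by (simp add: tendsto_cong)
  from tendsto_unique[OF _ this lim] show ?thesis by simp
qed

lemma funpow: "0 \<le> u \<Longrightarrow> (T u ^^ l) f = T (real l * u) f"
  by (induction l) (simp_all add: zero add[symmetric] algebra_simps)

lemma orbit_increment:
  assumes "0 \<le> u" "0 \<le> v"
  shows "norm (T u f - T v f) \<le> norm (T \<bar>u - v\<bar> f - f)"
  using assms
proof (induction u v rule: linorder_wlog)
  case (le u v)
  have "T v f - T u f = T u (T (v - u) f - f)"
    using le by (simp add: diff add[symmetric])
  then show ?case
    using contraction[of u "T (v - u) f - f"] le by (simp add: norm_minus_commute[of "T u f"])
next
  case (sym u v)
  then show ?case by (simp add: norm_minus_commute abs_minus_commute)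
qed

lemma continuous_orbit: "continuous_on {0..} (\<lambda>u. T u f)"
  unfolding continuous_on_iff
proof (intro ballI allI impI)
  fix u e :: real assume u: "u \<in> {0..}" and "0 < e"
  have "\<forall>\<^sub>F t in at_right 0. norm (T t f - f) < e"
    using order_tendstoD(2)[OF tendsto_norm \<open>0 < e\<close>] .
  then obtain d where d: "0 < d" "\<And>t. 0 < t \<Longrightarrow> t < d \<Longrightarrow> norm (T t f - f) < e"
    by (auto simp: eventually_at_right_field)
  have "dist (T v f) (T u f) < e" if v: "v \<in> {0..}" "dist v u < d" for v
  proof -
    have "norm (T \<bar>v - u\<bar> f - f) < e"
      using v d \<open>0 < e\<close> by (cases "v = u") (auto simp: zero dist_real_def)
    then show ?thesis
      using orbit_increment[of v u f] u v by (simp add: dist_norm)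
  qed
  then show "\<exists>d>0. \<forall>v\<in>{0..}. dist v u < d \<longrightarrow> dist (T v f) (T u f) < e"
    using \<open>0 < d\<close> by blast
qed

lemma difference_eq_sum:
  assumes "0 \<le> u"
  shows "difference (T u) n f
    = (\<Sum>l\<le>n. ((-1) ^ (n + l) * real (n choose l)) *\<^sub>R T (real l * u) f)"
  by (simp add: difference_expansion[OF linear[OF assms]] funpow[OF assms])

lemma continuous_difference: "continuous_on {0..} (\<lambda>u. difference (T u) n f)"
proof -
  have "continuous_on {0..} (\<lambda>u. \<Sum>l\<le>n. ((-1) ^ (n + l) * real (n choose l)) *\<^sub>R T (real l * u) f)"
    by (intro continuous_intros continuous_on_compose2[OF continuous_orbit]) auto
  then show ?thesis
    by (subst continuous_on_cong) (auto simp: difference_eq_sum)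
qed

lemma difference_le:
  assumes "0 \<le> u"
  shows "norm (difference (T u) n f) \<le> 2 ^ n * norm f"
proof (induction n)
  case (Suc n)
  then show ?case
    using norm_triangle_ineq4[of "T u (difference (T u) n f)" "difference (T u) n f"]
      contraction[OF assms, of "difference (T u) n f"] by simp
qed simp

lemma difference_le_modulus:
  assumes "0 \<le> u" "u \<le> t"
  shows "norm (difference (T u) n f) \<le> semigroup_modulus T n f t"
  unfolding semigroup_modulus_def
proof (rule cSUP_upper)
  show "bdd_above ((\<lambda>u. norm (difference (T u) n f)) ` {0..t})"
    by (rule bdd_aboveI2[where M = "2 ^ n * norm f"]) (simp add: difference_le)
qed (use assms in simp)

lemma modulus_nonneg: "0 \<le> t \<Longrightarrow> 0 \<le> semigroup_modulus T n f t"
  by (rule order_trans[OF norm_ge_zero difference_le_modulus[of 0 t n f]]) auto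

section \<open>Comparison of suprema with mean values\<close>

text \<open>
  With \<open>c\<^sub>k = (-1)\<^sup>k (n choose k)\<close>, both families of terms expand, up to the common sign \<open>(-1)\<^sup>n\<close>, into
  double sums over \<open>k, l \<le> n\<close> with weights \<open>c\<^sub>k c\<^sub>l\<close>, of \<open>T (k h + k l v)\<close> and \<open>T (l h + k l v)\<close>
  respectively. Swapping \<open>k\<close> and \<open>l\<close> identifies them, so the alternating sum over all \<open>k \<le> n\<close>
  vanishes. Its term for \<open>k = 0\<close> is \<open>- D\<^sub>h\<^sup>n f\<close>, because \<open>D\<^sub>0 = 0\<close>.
\<close>

lemma difference_identity:
  assumes "0 \<le> h" "0 \<le> v" "1 \<le> n"
  shows "difference (T h) n f = (\<Sum>k=1..n. ((-1) ^ k * real (n choose k)) *\<^sub>R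
    (T (real k * h) (difference (T (real k * v)) n f) - difference (T (h + real k * v)) n f))"
proof -
  define c :: "nat \<Rightarrow> real" where "c k = (-1) ^ k * real (n choose k)" for k
  define P where "P k = T (real k * h) (difference (T (real k * v)) n f)" for k
  define Q where "Q k = difference (T (h + real k * v)) n f" for k
  have P: "P k = (-1) ^ n *\<^sub>R (\<Sum>l\<le>n. c l *\<^sub>R T (real k * h + real k * real l * v) f)" for k
    unfolding P_def using assms linear[of "real k * h"]
    by (simp add: difference_eq_sum linear_sum linear_scale add c_def power_add scaleR_sum_right
        mult.assoc mult.left_commute)
  have Q: "Q k = (-1) ^ n *\<^sub>R (\<Sum>l\<le>n. c l *\<^sub>R T (real l * h + real k * real l * v) f)" for k
    unfolding Q_def using assms
    by (simp add: difference_eq_sum c_def power_add scaleR_sum_right algebra_simps)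
  have "(\<Sum>k\<le>n. c k *\<^sub>R P k)
      = (-1) ^ n *\<^sub>R (\<Sum>k\<le>n. \<Sum>l\<le>n. (c k * c l) *\<^sub>R T (real k * h + real k * real l * v) f)"
    by (simp add: P scaleR_sum_right mult.left_commute)
  also have "\<dots> = (-1) ^ n *\<^sub>R (\<Sum>l\<le>n. \<Sum>k\<le>n. (c k * c l) *\<^sub>R T (real k * h + real k * real l * v) f)"
    by (subst sum.swap) simp
  also have "\<dots> = (\<Sum>l\<le>n. c l *\<^sub>R Q l)"
    by (simp add: Q scaleR_sum_right mult.left_commute mult.commute)
  finally have "(\<Sum>k\<le>n. c k *\<^sub>R (P k - Q k)) = 0"
    by (simp add: scaleR_diff_right sum_subtractf)
  moreover have "{..n} = insert 0 {1..n}" by auto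
  moreover have "P 0 = 0"
  proof -
    obtain q where "n = Suc q" using \<open>1 \<le> n\<close> by (cases n) auto
    then have "difference (T 0) n f = 0" by (simp add: zero)
    then show ?thesis by (simp add: P_def zero)
  qed
  moreover have "c 0 = 1" "Q 0 = difference (T h) n f" by (simp_all add: c_def Q_def)
  ultimately have "difference (T h) n f = (\<Sum>k=1..n. c k *\<^sub>R (P k - Q k))"
    by simp
  then show ?thesis by (simp only: c_def P_def Q_def)
qed

lemma difference_powr_le_sum:
  assumes "0 \<le> h" "0 \<le> v" "1 \<le> n" "0 < s"
  shows "norm (difference (T h) n f) powr s \<le> (2 ^ Suc n * real n) powr s *
    (\<Sum>k=1..n. norm (difference (T (real k * v)) n f) powr s
      + norm (difference (T (h + real k * v)) n f) powr s)"
proof -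
  let ?p = "\<lambda>k. norm (difference (T (real k * v)) n f)"
  let ?q = "\<lambda>k. norm (difference (T (h + real k * v)) n f)"
  have "norm (difference (T h) n f) \<le> (\<Sum>k=1..n. 2 ^ n * (?p k + ?q k))"
    unfolding difference_identity[OF assms(1-3)]
  proof (rule sum_norm_le)
    fix k assume "k \<in> {1..n}"
    let ?x = "T (real k * h) (difference (T (real k * v)) n f)"
    let ?y = "difference (T (h + real k * v)) n f"
    have le: "norm (?x - ?y) \<le> ?p k + ?q k"
      using norm_triangle_ineq4[of ?x ?y] contraction[of "real k * h" "difference (T (real k * v)) n f"]
        assms by simp
    have "real (n choose k) \<le> real (2 ^ n)"
      using binomial_le_pow2[of n k] by (simp only: of_nat_le_iff)
    then have "real (n choose k) \<le> 2 ^ n" by simp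
    then show "norm (((-1) ^ k * real (n choose k)) *\<^sub>R (?x - ?y)) \<le> 2 ^ n * (?p k + ?q k)"
      using le by (simp add: abs_mult mult_mono)
  qed
  then have "norm (difference (T h) n f) powr s \<le> (2 ^ n * (\<Sum>k=1..n. ?p k + ?q k)) powr s"
    using \<open>0 < s\<close> by (intro powr_mono2) (simp_all add: sum_distrib_left)
  also have "\<dots> = (2 ^ n) powr s * (\<Sum>k=1..n. ?p k + ?q k) powr s"
    by (simp add: powr_mult sum_nonneg)
  also have "\<dots> \<le> (2 ^ n) powr s * (real n powr s * (\<Sum>k=1..n. (?p k + ?q k) powr s))"
    using powr_sum_le[of "{1..n}" "\<lambda>k. ?p k + ?q k" s] \<open>0 < s\<close>
    by (intro mult_left_mono) auto
  also have "\<dots> \<le> (2 ^ n) powr s * (real n powr s * (\<Sum>k=1..n. 2 powr s * (?p k powr s + ?q k powr s)))"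
    using powr_sum_le[of "UNIV :: bool set" "\<lambda>b. if b then x else y" s for x y] \<open>0 < s\<close>
    by (intro mult_left_mono sum_mono) (auto simp: UNIV_bool add.commute)
  also have "\<dots> = (2 ^ Suc n * real n) powr s * (\<Sum>k=1..n. ?p k powr s + ?q k powr s)"
    by (simp add: powr_mult sum_distrib_left[symmetric])
  finally show ?thesis .
qed

lemma continuous_difference_powr:
  "0 < s \<Longrightarrow> continuous_on {0..} (\<lambda>u. norm (difference (T u) n f) powr s)"
  by (intro continuous_on_powr' continuous_intros continuous_difference) auto

lemma integrable_difference_powr:
  assumes "0 < s" "0 \<le> a" "0 \<le> b"
  shows "(\<lambda>x. norm (difference (T (b + a * x)) n f) powr s) integrable_on {0..1}"
  using assms
  by (intro integrable_continuous_interval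
      continuous_on_compose2[OF continuous_difference_powr[OF \<open>0 < s\<close>]] continuous_intros) auto

text \<open>
  The free step is taken as \<open>v = x \<tau> / n\<close> with \<open>x \<in> [0, 1]\<close>, so that \<open>k v \<le> \<tau>\<close> and \<open>h + k v \<le> 2 \<tau>\<close>
  for all \<open>k \<le> n\<close>. Each of the \<open>2 n\<close> terms then averages over a subinterval of \<open>[0, 2 \<tau>]\<close> of
  length \<open>k \<tau> / n \<ge> \<tau> / n\<close>, which costs at most the factor \<open>2 n\<close> compared with the full mean.
\<close>

lemma difference_le_average:
  assumes "0 \<le> h" "h \<le> \<tau>" "0 < \<tau>" "1 \<le> n" "0 < s"
  shows "norm (difference (T h) n f) powr s \<le> (2 ^ Suc n * real n) powr s * (4 * real n ^ 2) *
    integral {0..1} (\<lambda>x. norm (difference (T (2 * \<tau> * x)) n f) powr s)"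
proof -
  let ?\<phi> = "\<lambda>u. norm (difference (T u) n f) powr s"
  let ?J = "integral {0..1} (\<lambda>x. ?\<phi> (2 * \<tau> * x))"
  let ?M = "(2 ^ Suc n * real n) powr s"
  let ?a = "\<lambda>k. real k * \<tau> / real n"
  have J: "0 \<le> ?J"
    using integrable_difference_powr[of s "2 * \<tau>" 0] assms by (intro integral_nonneg) auto
  have part: "integral {0..1} (\<lambda>x. ?\<phi> (b + ?a k * x)) \<le> 2 * real n * ?J"
    if "k \<in> {1..n}" "0 \<le> b" "b \<le> \<tau>" for k b
  proof -
    have a: "0 < ?a k" "?a k \<le> \<tau>" "\<tau> \<le> real n * ?a k" using that assms by (auto simp: field_simps)
    have "?a k * integral {0..1} (\<lambda>x. ?\<phi> (b + ?a k * x)) \<le> 2 * \<tau> * ?J"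
      using a that assms by (intro integral_affine_le continuous_difference_powr) auto
    also have "\<dots> \<le> 2 * (real n * ?a k) * ?J"
      using a J by (intro mult_right_mono mult_left_mono) auto
    also have "\<dots> = ?a k * (2 * real n * ?J)" by simp
    finally show ?thesis using a(1) by (simp only: mult_le_cancel_left_pos)
  qed
  have int: "(\<lambda>x. ?\<phi> (b + ?a k * x)) integrable_on {0..1}" if "0 \<le> b" for b k
    using that assms by (intro integrable_difference_powr) auto
  have "?\<phi> h = integral {0..1} (\<lambda>x::real. ?\<phi> h)" by simp
  also have "\<dots> \<le> integral {0..1} (\<lambda>x. ?M * (\<Sum>k=1..n. ?\<phi> (0 + ?a k * x) + ?\<phi> (h + ?a k * x)))"
  proof (rule integral_le)
    show "(\<lambda>x. ?M * (\<Sum>k=1..n. ?\<phi> (0 + ?a k * x) + ?\<phi> (h + ?a k * x))) integrable_on {0..1}"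
      using \<open>0 \<le> h\<close>
      by (intro integrable_on_mult_right integrable_sum integrable_add int) simp_all
    fix x :: real assume "x \<in> {0..1}"
    then have "0 \<le> x * \<tau> / real n" using assms by simp
    from difference_powr_le_sum[OF \<open>0 \<le> h\<close> this \<open>1 \<le> n\<close> \<open>0 < s\<close>, of f]
    show "?\<phi> h \<le> ?M * (\<Sum>k=1..n. ?\<phi> (0 + ?a k * x) + ?\<phi> (h + ?a k * x))"
      by (simp add: mult_ac)
  qed auto
  also have "\<dots> = ?M * (\<Sum>k=1..n. integral {0..1} (\<lambda>x. ?\<phi> (0 + ?a k * x))
      + integral {0..1} (\<lambda>x. ?\<phi> (h + ?a k * x)))"
  proof -
    have "integral {0..1} (\<lambda>x. \<Sum>k=1..n. ?\<phi> (0 + ?a k * x) + ?\<phi> (h + ?a k * x))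
        = (\<Sum>k=1..n. integral {0..1} (\<lambda>x. ?\<phi> (0 + ?a k * x) + ?\<phi> (h + ?a k * x)))"
      using \<open>0 \<le> h\<close> by (intro integral_sum integrable_add int) simp_all
    also have "\<dots> = (\<Sum>k=1..n. integral {0..1} (\<lambda>x. ?\<phi> (0 + ?a k * x))
        + integral {0..1} (\<lambda>x. ?\<phi> (h + ?a k * x)))"
      using \<open>0 \<le> h\<close> by (intro sum.cong refl integral_add int) simp_all
    finally show ?thesis by (simp only: integral_mult_right)
  qed
  also have "\<dots> \<le> ?M * (\<Sum>k=1..n. 2 * real n * ?J + 2 * real n * ?J)"
    using assms by (intro mult_left_mono sum_mono add_mono part) auto
  also have "\<dots> = ?M * (4 * real n ^ 2) * ?J"
    by (simp add: power2_eq_square)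
  finally show ?thesis .
qed

lemma modulus_le_average:
  assumes "0 < \<tau>" "1 \<le> n" "0 < s"
  shows "semigroup_modulus T n f \<tau> powr s \<le> (2 ^ Suc n * real n) powr s * (4 * real n ^ 2) *
    integral {0..1} (\<lambda>x. norm (difference (T (2 * \<tau> * x)) n f) powr s)" (is "_ \<le> ?R")
proof -
  have "0 \<le> ?R"
    using assms by (intro order_trans[OF powr_ge_zero difference_le_average[of 0 \<tau> n s f]]) auto
  have "semigroup_modulus T n f \<tau> \<le> ?R powr (1 / s)"
    unfolding semigroup_modulus_def
  proof (rule cSUP_least)
    fix u assume "u \<in> {0..\<tau>}"
    then have "norm (difference (T u) n f) powr s \<le> ?R"
      using assms by (intro difference_le_average) auto
    then have "(norm (difference (T u) n f) powr s) powr (1 / s) \<le> ?R powr (1 / s)"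
      using \<open>0 < s\<close> by (intro powr_mono2) auto
    then show "norm (difference (T u) n f) \<le> ?R powr (1 / s)"
      using \<open>0 < s\<close> by (simp add: powr_powr)
  qed (use assms in auto)
  then have "semigroup_modulus T n f \<tau> powr s \<le> (?R powr (1 / s)) powr s"
    using assms modulus_nonneg[of \<tau> n f] by (intro powr_mono2) auto
  then show ?thesis using \<open>0 < s\<close> \<open>0 \<le> ?R\<close> by (simp add: powr_powr)
qed

section \<open>The dyadic sum\<close>

lemma difference_ge_dyadic_sum:
  assumes "0 < s" and "0 < m" and "1 \<le> r"
    and convex: "\<And>F G :: 'a. max (norm (F + G)) (norm (F - G))
            \<ge> (norm F powr s + m * norm G powr s) powr (1 / s)"
    and "0 \<le> u"
  shows "m * 2 powr (- s) * (\<Sum>j<N. 2 powr (- (real j * real r * s))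
      * norm (difference (T (2 ^ j * u)) (Suc r) f) powr s)
    \<le> norm (difference (T u) r f) powr s"
  using \<open>0 \<le> u\<close>
proof (induction N arbitrary: u)
  case 0
  then show ?case by simp
next
  case (Suc N)
  let ?b = "2 powr (- (real r * s))"
  let ?\<psi> = "\<lambda>u. norm (difference (T u) (Suc r) f) powr s"
  have scale: "2 powr (- (real (Suc j) * real r * s)) = ?b * 2 powr (- (real j * real r * s))" for j
    by (simp add: powr_add[symmetric] algebra_simps)
  have "T u \<circ> T u = T (2 * u)"
    using Suc.prems by (auto simp: fun_eq_iff add[symmetric])
  then have step: "?b * norm (difference (T (2 * u)) r f) powr s + m * 2 powr (- s) * ?\<psi> u
      \<le> norm (difference (T u) r f) powr s"
    using difference_doubling[OF linear contraction assms(1-3) convex, of u f] Suc.prems by simp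
  have tail: "?b * (m * 2 powr (- s) * (\<Sum>j<N. 2 powr (- (real j * real r * s)) * ?\<psi> (2 ^ j * (2 * u))))
      \<le> ?b * norm (difference (T (2 * u)) r f) powr s"
    using Suc.prems by (intro mult_left_mono Suc.IH) auto
  have split: "(\<Sum>j<Suc N. 2 powr (- (real j * real r * s)) * ?\<psi> (2 ^ j * u))
      = ?\<psi> u + ?b * (\<Sum>j<N. 2 powr (- (real j * real r * s)) * ?\<psi> (2 ^ j * (2 * u)))"
    by (simp only: sum.lessThan_Suc_shift scale sum_distrib_left) (simp add: mult_ac)
  have combine: "c * (p + b * X) \<le> Z" if "b * Y + c * p \<le> Z" "b * (c * X) \<le> b * Y"
    for b c p X Y Z :: real
    using that by (simp add: algebra_simps)
  show ?case
    unfolding split by (rule combine[OF step tail])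
qed

text \<open>
  Integrating the pointwise dyadic inequality at \<open>u = t x\<close> over \<open>x \<in> [0, 1]\<close> gives mean values at
  the scales \<open>2\<^sup>j t\<close>. The mean at scale \<open>2\<^sup>i\<^sup>+\<^sup>2 t\<close> dominates the modulus at \<open>2\<^sup>i\<^sup>+\<^sup>1 t\<close>, whence the
  \<open>N + 2\<close> integrated terms for \<open>N\<close> moduli.
\<close>

lemma partial_sum_le_modulus:
  assumes "0 < s" and "0 < m" and "1 \<le> r" and "0 < t"
    and convex: "\<And>F G :: 'a. max (norm (F + G)) (norm (F - G))
            \<ge> (norm F powr s + m * norm G powr s) powr (1 / s)"
  defines "K \<equiv> (2 ^ Suc (Suc r) * real (Suc r)) powr s * (4 * real (Suc r) ^ 2)"
  shows "(\<Sum>i<N. 2 powr (- (real (Suc i) * real r * s))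
        * semigroup_modulus T (Suc r) f (2 ^ Suc i * t) powr s)
    \<le> K * 2 powr (real r * s) / (m * 2 powr (- s)) * semigroup_modulus T r f t powr s"
proof -
  let ?w = "\<lambda>j. 2 powr (- (real j * real r * s))"
  let ?\<psi> = "\<lambda>u. norm (difference (T u) (Suc r) f) powr s"
  let ?I = "\<lambda>j. integral {0..1} (\<lambda>x. ?\<psi> (2 ^ j * t * x))"
  let ?c = "m * 2 powr (- s)"
  have K: "0 \<le> K" by (simp add: K_def)
  have int: "(\<lambda>x. ?\<psi> (2 ^ j * t * x)) integrable_on {0..1}" for j
    using integrable_difference_powr[of s "2 ^ j * t" 0 "Suc r" f] \<open>0 < s\<close> \<open>0 < t\<close>
    by (simp del: funpow.simps)
  have I: "0 \<le> ?I j" for j by (intro integral_nonneg int powr_ge_zero)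
  have tail: "(\<Sum>i<N. a (i + 2)) \<le> (\<Sum>j<N + 2. a j)" if "\<And>j. 0 \<le> a j" for a :: "nat \<Rightarrow> real"
    using that[of 0] that[of 1] by (simp add: sum.lessThan_Suc_shift del: sum.lessThan_Suc)
  \<comment> \<open>The mean of the pointwise inequality over \<open>u = t x\<close>.\<close>
  have "?c * (\<Sum>j<N + 2. ?w j * ?I j)
      = integral {0..1} (\<lambda>x. ?c * (\<Sum>j<N + 2. ?w j * ?\<psi> (2 ^ j * t * x)))"
  proof -
    have "integral {0..1} (\<lambda>x. \<Sum>j<N + 2. ?w j * ?\<psi> (2 ^ j * t * x))
        = (\<Sum>j<N + 2. integral {0..1} (\<lambda>x. ?w j * ?\<psi> (2 ^ j * t * x)))"
      by (intro integral_sum finite_lessThan integrable_on_mult_right int)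
    then show ?thesis by (simp only: integral_mult_right)
  qed
  also have "\<dots> \<le> integral {0..1} (\<lambda>x::real. semigroup_modulus T r f t powr s)"
  proof (rule integral_le)
    show "(\<lambda>x. ?c * (\<Sum>j<N + 2. ?w j * ?\<psi> (2 ^ j * t * x))) integrable_on {0..1}"
      by (intro integrable_on_mult_right integrable_sum finite_lessThan int)
    fix x :: real assume x: "x \<in> {0..1}"
    have "?c * (\<Sum>j<N + 2. ?w j * ?\<psi> (2 ^ j * (t * x))) \<le> norm (difference (T (t * x)) r f) powr s"
      using x \<open>0 < t\<close> by (intro difference_ge_dyadic_sum assms(1-3) convex) auto
    also have "\<dots> \<le> semigroup_modulus T r f t powr s"
      using x \<open>0 < t\<close> \<open>0 < s\<close> by (intro powr_mono2 difference_le_modulus) (auto simp: mult_left_le)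
    finally show "?c * (\<Sum>j<N + 2. ?w j * ?\<psi> (2 ^ j * t * x)) \<le> semigroup_modulus T r f t powr s"
      by (simp only: mult.assoc)
  qed auto
  finally have upper: "(\<Sum>j<N + 2. ?w j * ?I j) \<le> semigroup_modulus T r f t powr s / ?c"
    using \<open>0 < m\<close> by (simp add: pos_le_divide_eq mult_ac)
  have "(\<Sum>i<N. ?w (Suc i) * semigroup_modulus T (Suc r) f (2 ^ Suc i * t) powr s)
      \<le> (\<Sum>i<N. ?w (Suc i) * (K * ?I (i + 2)))"
  proof (intro sum_mono mult_left_mono)
    fix i
    show "semigroup_modulus T (Suc r) f (2 ^ Suc i * t) powr s \<le> K * ?I (i + 2)"
      using modulus_le_average[of "2 ^ Suc i * t" "Suc r" s f] assms(1,4) by (simp add: K_def mult_ac)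
  qed auto
  \<comment> \<open>Moduli at scale \<open>2\<^sup>i\<^sup>+\<^sup>1 t\<close> carry the weight of index \<open>i + 1\<close>, the means bounding them that of \<open>i + 2\<close>.\<close>
  also have "\<dots> = K * 2 powr (real r * s) * (\<Sum>i<N. ?w (i + 2) * ?I (i + 2))"
  proof -
    have "?w (Suc i) = 2 powr (real r * s) * ?w (i + 2)" for i
      by (simp add: powr_add[symmetric] algebra_simps)
    then show ?thesis by (simp only: sum_distrib_left) (simp only: mult_ac)
  qed
  also have "(\<Sum>i<N. ?w (i + 2) * ?I (i + 2)) \<le> (\<Sum>j<N + 2. ?w j * ?I j)"
    by (intro tail mult_nonneg_nonneg I powr_ge_zero)
  also note upper
  finally show ?thesis using K by (simp add: mult_left_mono)
qed

end

theorem theorem8p2: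
  fixes T :: "real \<Rightarrow> 'a \<Rightarrow> 'a::banach" and s m :: real and r :: nat
  assumes "c0_contraction_semigroup T"
    and "2 \<le> s" and "0 < m"
    and "\<And>F G :: 'a. max (norm (F + G)) (norm (F - G))
            \<ge> (norm F powr s + m * norm G powr s) powr (1 / s)"
    and "1 \<le> r"
  shows "\<exists>C>0. \<forall>f. \<forall>t>0.
           summable (\<lambda>i. 2 powr (- (real (Suc i) * real r * s))
                        * semigroup_modulus T (r + 1) f (2 ^ Suc i * t) powr s) \<and>
           semigroup_modulus T r f t
             \<ge> C * (\<Sum>i. 2 powr (- (real (Suc i) * real r * s))
                        * semigroup_modulus T (r + 1) f (2 ^ Suc i * t) powr s) powr (1 / s)"
proof -
  interpret contraction_semigroup T by unfold_locales (rule assms(1))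
  have s: "0 < s" using \<open>2 \<le> s\<close> by simp
  define D where "D = (2 ^ Suc (Suc r) * real (Suc r)) powr s * (4 * real (Suc r) ^ 2)
    * 2 powr (real r * s) / (m * 2 powr (- s))"
  have D: "0 < D" using \<open>0 < m\<close> by (simp add: D_def)
  show ?thesis
  proof (intro exI[of _ "(1 / D) powr (1 / s)"] conjI allI impI)
    show "0 < (1 / D) powr (1 / s)" using D by simp
  next
    fix f and t :: real assume t: "0 < t"
    let ?a = "\<lambda>i. 2 powr (- (real (Suc i) * real r * s))
      * semigroup_modulus T (r + 1) f (2 ^ Suc i * t) powr s"
    let ?\<omega> = "semigroup_modulus T r f t"
    have partial: "(\<Sum>i<N. ?a i) \<le> D * ?\<omega> powr s" for N
      using partial_sum_le_modulus[OF s \<open>0 < m\<close> \<open>1 \<le> r\<close> t assms(4)] by (simp add: D_def)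
    show summable: "summable ?a"
      by (rule summableI_nonneg_bounded[OF _ partial]) simp
    have "(\<Sum>i. ?a i) \<le> D * ?\<omega> powr s"
      by (rule suminf_le_const[OF summable partial])
    then have "(1 / D) * (\<Sum>i. ?a i) \<le> ?\<omega> powr s"
      using D by (simp add: field_simps)
    then have "((1 / D) * (\<Sum>i. ?a i)) powr (1 / s) \<le> (?\<omega> powr s) powr (1 / s)"
      using D s suminf_nonneg[OF summable] by (intro powr_mono2) auto
    then show "(1 / D) powr (1 / s) * (\<Sum>i. ?a i) powr (1 / s) \<le> ?\<omega>"
      using D s modulus_nonneg[of t r f] t suminf_nonneg[OF summable]
      by (simp add: powr_divide powr_powr)
  qed
qed

end
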